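(* Let $(X,d)$ be a metric space, $f:X\to\mathbb{R}\cup\{\pm\infty\}$ a function and $\bar x\in X$ a point with $|f(\bar x)|<\infty$. Then $\bar x$ is a local sharp minimizer of $f$ if and only if $f^\downarrow(\bar x)>0$. Moreover, in this case, $f^\downarrow(\bar x)=\mathrm{sha}(f,\bar x)$.
   Context: $B(x,r)$ denotes the closed ball with center $x$ and radius $r$. The steepest descent rate of $f$ at $\bar x$ is $f^\downarrow(\bar x)=\liminf_{x\to\bar x}\frac{f(x)-f(\bar x)}{d(x,\bar x)}=\sup_{\delta>0}\inf_{x\in B(\bar x,\delta)\setminus\{\bar x\}}\frac{f(x)-f(\bar x)}{d(x,\bar x)}$ (with $\inf\varnothing=+\infty$, so the value is $+\infty$ if $\bar x$ is isolated). The point $\bar x$ is a local sharp minimizer of $f$ if there exist $\sigma>0$ and $r>0$ such that $f(x)\ge f(\bar x)+\sigma d(x,\bar x)$ for all $x\in B(\bar x,r)$. The modulus of local sharpness is $\mathrm{sha}(f,\bar x)=\sup\{\sigma>0:\ \exists r>0 \text{ such that } f(x)\ge f(\bar x)+\sigma d(x,\bar x)\ \forall x\in B(\bar x,r)\}\in(0,+\infty]$ (defined when $\bar x$ is a local sharp minimizer). *)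

theory Defs
  imports "HOL-Analysis.Analysis"
begin

definition steepest_descent_rate :: "('a::metric_space \<Rightarrow> ereal) \<Rightarrow> 'a \<Rightarrow> ereal" where
  "steepest_descent_rate f a = Liminf (at a) (\<lambda>x. (f x - f a) / ereal (dist x a))"

text \<open>Since \<open>at a\<close> is the trivial filter when \<open>a\<close> is isolated, and the infimum of the empty set
  is \<open>\<infinity>\<close>, the rate at an isolated point is \<open>\<infinity>\<close>. The following is the
  description of the rate by punctured closed balls.\<close>

lemma steepest_descent_rate_eq_SUP_INF:
  "steepest_descent_rate f a =
     (SUP \<delta>\<in>{0<..}. INF x\<in>cball a \<delta> - {a}. (f x - f a) / ereal (dist x a))"
proof (rule antisym)
  let ?q = "\<lambda>x. (f x - f a) / ereal (dist x a)"
  let ?S = "SUP \<delta>\<in>{0<..}. INF x\<in>cball a \<delta> - {a}. ?q x"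
  have "(INF x\<in>Collect P. ?q x) \<le> ?S" if P: "eventually P (at a)" for P
  proof -
    obtain d where d: "d > 0" "\<And>x. x \<noteq> a \<Longrightarrow> dist x a \<le> d \<Longrightarrow> P x"
      using P unfolding eventually_at_le by auto
    then have "(INF x\<in>Collect P. ?q x) \<le> (INF x\<in>cball a d - {a}. ?q x)"
      by (intro INF_superset_mono) (auto simp: dist_commute)
    also have "\<dots> \<le> ?S"
      using d(1) by (intro SUP_upper) auto
    finally show ?thesis .
  qed
  then show "steepest_descent_rate f a \<le> ?S"
    unfolding steepest_descent_rate_def Liminf_def by (intro SUP_least) auto
  have "(INF x\<in>cball a d - {a}. ?q x) \<le> Liminf (at a) ?q" if "d > 0" for d
  proof -
    have "eventually (\<lambda>x. x \<in> cball a d - {a}) (at a)"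
      using that unfolding eventually_at_le by (intro exI[of _ d]) (auto simp: dist_commute)
    then have "(INF x\<in>Collect (\<lambda>x. x \<in> cball a d - {a}). ?q x) \<le> Liminf (at a) ?q"
      unfolding Liminf_def by (intro SUP_upper) auto
    then show ?thesis by (simp only: Collect_mem_eq)
  qed
  then show "?S \<le> steepest_descent_rate f a"
    unfolding steepest_descent_rate_def by (intro SUP_least) auto
qed

definition sharp_with_modulus :: "('a::metric_space \<Rightarrow> ereal) \<Rightarrow> 'a \<Rightarrow> real \<Rightarrow> bool" where
  "sharp_with_modulus f a \<sigma> \<longleftrightarrow>
     (\<exists>r>0. \<forall>x\<in>cball a r. f x \<ge> f a + ereal (\<sigma> * dist x a))"

definition local_sharp_minimizer :: "('a::metric_space \<Rightarrow> ereal) \<Rightarrow> 'a \<Rightarrow> bool" where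
  "local_sharp_minimizer f a \<longleftrightarrow> (\<exists>\<sigma>>0. sharp_with_modulus f a \<sigma>)"

text \<open>The modulus is meaningful only if \<open>a\<close> is a local sharp minimizer of \<open>f\<close>; otherwise the
  supremum is over the empty set and the value \<open>-\<infinity>\<close> is a dummy.\<close>

definition sharpness_modulus :: "('a::metric_space \<Rightarrow> ereal) \<Rightarrow> 'a \<Rightarrow> ereal" where
  "sharpness_modulus f a = (SUP \<sigma>\<in>{\<sigma>. \<sigma> > 0 \<and> sharp_with_modulus f a \<sigma>}. ereal \<sigma>)"

end

theory Submission
  imports Defs
begin

text \<open>Away from the center \<open>a\<close>, the sharpness inequality with constant \<sigma>
  says exactly that the difference quotient is at least \<sigma>. Hence sharpness with \<sigma>
  bounds the quotient below near \<open>a\<close>, so \<sigma> is at most the rate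
  (\<open>le_steepest_descent_rate\<close>); conversely, every real below the liminf is such a bound
  on some punctured ball (\<open>sharp_with_modulus_if_less_rate\<close>). The admissible \<sigma> >
  0 are thus all positive reals below the rate and possibly the rate itself: they exist iff the rate
  is positive, and then their supremum is the rate.\<close>

text \<open>Finiteness of \<open>c\<close> and positivity of \<open>d\<close> allow clearing the
  denominator as for reals, even when \<open>y\<close> is infinite.\<close>

lemma ereal_le_diff_quotient_iff:
  fixes c y :: ereal and d s :: real
  assumes "\<bar>c\<bar> < \<infinity>" "d > 0"
  shows "ereal s \<le> (y - c) / ereal d \<longleftrightarrow> c + ereal (s * d) \<le> y"
  using assms by (cases c; cases y) (auto simp: field_simps)

lemma le_steepest_descent_rate:
  assumes "\<bar>f a\<bar> < \<infinity>" "sharp_with_modulus f a \<sigma>"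
  shows "ereal \<sigma> \<le> steepest_descent_rate f a"
proof -
  obtain r where r: "r > 0" "\<And>x. x \<in> cball a r \<Longrightarrow> f a + ereal (\<sigma> * dist x a) \<le> f x"
    using assms(2) unfolding sharp_with_modulus_def by blast
  then show ?thesis
    unfolding steepest_descent_rate_def
    by (intro Liminf_bounded, unfold eventually_at_le)
      (auto intro!: exI[of _ r] simp: ereal_le_diff_quotient_iff[OF assms(1)] dist_commute)
qed

text \<open>Strictness turns the liminf bound into a bound on a whole punctured ball. Equality would
  not do: |x| - x^2 has rate 1 at 0 but is not sharp there with \<sigma> = 1.\<close>

lemma sharp_with_modulus_if_less_rate:
  assumes "\<bar>f a\<bar> < \<infinity>" "ereal \<sigma> < steepest_descent_rate f a"
  shows "sharp_with_modulus f a \<sigma>"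
proof -
  have "eventually (\<lambda>x. ereal \<sigma> < (f x - f a) / ereal (dist x a)) (at a)"
    using less_LiminfD assms(2) unfolding steepest_descent_rate_def by blast
  then obtain r where r: "r > 0"
    "\<And>x. x \<noteq> a \<Longrightarrow> dist x a \<le> r \<Longrightarrow> ereal \<sigma> < (f x - f a) / ereal (dist x a)"
    unfolding eventually_at_le by auto
  have "f a + ereal (\<sigma> * dist x a) \<le> f x" if "x \<in> cball a r" for x
  \<comment> \<open>The quotient bound says nothing at the center, where the inequality is
    trivial.\<close>
  proof (cases "x = a")
    case False
    then show ?thesis
      using r(2)[OF False] that ereal_le_diff_quotient_iff[OF assms(1), of "dist x a" \<sigma> "f x"]
      by (simp add: dist_commute order_less_imp_le)
  qed simp
  with r(1) show ?thesis
    unfolding sharp_with_modulus_def by blast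
qed

lemma steepest_descent_rate_le_sharpness_modulus:
  assumes "\<bar>f a\<bar> < \<infinity>" "steepest_descent_rate f a > 0"
  shows "steepest_descent_rate f a \<le> sharpness_modulus f a"
proof (rule dense_le)
  fix y assume "y < steepest_descent_rate f a"
  \<comment> \<open>The modulus ranges over positive \<sigma> only, so the real chosen next must
    exceed 0 as well as \<open>y\<close>.\<close>
  then have "max y 0 < steepest_descent_rate f a"
    using assms(2) by simp
  then obtain s where s: "max y 0 < ereal s" "ereal s < steepest_descent_rate f a"
    using ereal_dense2 by blast
  then have "ereal s \<le> sharpness_modulus f a"
    unfolding sharpness_modulus_def
    by (intro SUP_upper) (auto intro: sharp_with_modulus_if_less_rate assms(1))
  with s(1) show "y \<le> sharpness_modulus f a"
    by (auto intro: less_imp_le less_le_trans)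
qed

theorem proposition1:
  fixes f :: "'a::metric_space \<Rightarrow> ereal" and xbar :: 'a
  assumes "\<bar>f xbar\<bar> < \<infinity>"
  shows "(local_sharp_minimizer f xbar \<longleftrightarrow> steepest_descent_rate f xbar > 0) \<and>
         (local_sharp_minimizer f xbar \<longrightarrow>
            steepest_descent_rate f xbar = sharpness_modulus f xbar)"
proof -
  have pos: "steepest_descent_rate f xbar > 0" if sharp: "local_sharp_minimizer f xbar"
  proof -
    obtain s where "s > 0" "sharp_with_modulus f xbar s"
      using sharp unfolding local_sharp_minimizer_def by blast
    then have "0 < ereal s" "ereal s \<le> steepest_descent_rate f xbar"
      using le_steepest_descent_rate[where f = f and a = xbar, OF assms] by auto
    then show ?thesis
      by (rule less_le_trans)
  qed
  have min: "local_sharp_minimizer f xbar" if rate_pos: "steepest_descent_rate f xbar > 0"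
  proof -
    \<comment> \<open>The rate may be \<infinity>, so a real strictly below it serves as the
      sharpness constant.\<close>
    obtain s where "0 < ereal s" "ereal s < steepest_descent_rate f xbar"
      using ereal_dense2[OF rate_pos] by blast
    then show ?thesis
      unfolding local_sharp_minimizer_def
      using sharp_with_modulus_if_less_rate[where f = f and a = xbar, OF assms] by auto
  qed
  have "sharpness_modulus f xbar \<le> steepest_descent_rate f xbar"
    unfolding sharpness_modulus_def
    by (intro SUP_least) (auto intro: le_steepest_descent_rate[where f = f and a = xbar, OF assms])
  then show ?thesis
    using pos min steepest_descent_rate_le_sharpness_modulus[where f = f and a = xbar, OF assms] by (auto intro: antisym)
qed

end
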